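(* Any classical entropy maximization with $m$ expected-value constraints produces a contact structure that is invariant under Legendre transformations. Precisely: let $Q(X)$ be a prior probability distribution, let $\hat A_1,\dots,\hat A_m$ be real-valued functions of $X$, and let $S$ be the maximum of the relative entropy $S_r[P|Q]=-\sum_X(P\log P-P\log Q)$ over probability distributions $P$ subject to $\sum_XP(X)\hat A_i(X)=A_i$ ($1\le i\le m$), with associated Lagrange multipliers $\alpha_1,\dots,\alpha_m$. Then $$dS-\sum_{i=1}^m\alpha_i\,dA_i=0 .$$ Consequently, on the $(2m+1)$-dimensional manifold $\mathbb T$ with coordinates $(q_0,q_1,\dots,q_m,p_1,\dots,p_m)$ and one-form $\omega_{cl}=dq_0-\sum_{i=1}^mp_i\,dq_i$, the form $\omega_{cl}$ vanishes on the $m$-dimensional submanifold $\mathbb M$ determined by $$q_0=S(A_1,\dots,A_m),\qquad p_i=\alpha_i=\frac{\partial S}{\partial A_i}\qquad(q_i=A_i,\ 1\le i\le m).$$ Moreover, for every $1\le l\le m$, the one-form $\omega_{cl}$ is conserved under the Legendre transformation $$q_0\mapsto q_0-\sum_{j=1}^lp_jq_j,\qquad q_i\mapsto p_i,\quad p_i\mapsto-q_i\quad(1\le i\le l),$$ with the remaining coordinates unchanged.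
   Context: The maximizing distribution and the maximized entropy are $$P(X)=\frac{Q(X)}{Z}e^{-\sum_i\alpha_i\hat A_i(X)},\qquad Z=\sum_XQ(X)e^{-\sum_i\alpha_i\hat A_i(X)},\qquad S=\sum_i\alpha_iA_i+\log Z,$$ where the $\alpha_i$ are the Lagrange multipliers of the constraints. It is understood that $Z$ is finite and differentiable in the $\alpha_i$, and that the expected values $A_1,\dots,A_m$ serve as local coordinates, so that $S$ and the $\alpha_i$ are smooth functions of $(A_1,\dots,A_m)$. *)

theory Defs
  imports "HOL-Probability.Probability"
begin

subsection \<open>Smooth maps, one-forms and submanifolds in Euclidean spaces\<close>

text \<open>Continuous differentiability of order \<open>n\<close> and of every order; meant for open \<open>U\<close> in a
  finite-dimensional space.\<close>

primrec Ck_on :: "nat \<Rightarrow> 'a::euclidean_space set \<Rightarrow> ('a \<Rightarrow> 'b::euclidean_space) \<Rightarrow> bool" where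
  "Ck_on 0 U f \<longleftrightarrow> continuous_on U f"
| "Ck_on (Suc n) U f \<longleftrightarrow>
     (\<forall>x\<in>U. f differentiable (at x)) \<and>
     (\<forall>v. Ck_on n U (\<lambda>x. frechet_derivative f (at x) v))"

definition smooth_on :: "'a::euclidean_space set \<Rightarrow> ('a \<Rightarrow> 'b::euclidean_space) \<Rightarrow> bool" where
  "smooth_on U f \<longleftrightarrow> (\<forall>n. Ck_on n U f)"

definition diffeomorphism ::
  "'a::euclidean_space set \<Rightarrow> 'b::euclidean_space set \<Rightarrow> ('a \<Rightarrow> 'b) \<Rightarrow> bool" where
  "diffeomorphism W W' F \<longleftrightarrow>
     open W \<and> open W' \<and> bij_betw F W W' \<and> smooth_on W F \<and> smooth_on W' (inv_into W F)"

definition submanifold :: "nat \<Rightarrow> 'a::euclidean_space set \<Rightarrow> bool" where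
  "submanifold k M \<longleftrightarrow>
     (\<forall>x\<in>M. \<exists>W (W' :: 'a set) F L. x \<in> W \<and> diffeomorphism W W' F \<and>
        subspace L \<and> dim L = k \<and> F ` (M \<inter> W) = W' \<inter> L)"

definition tangent_space :: "'a::euclidean_space set \<Rightarrow> 'a \<Rightarrow> 'a set" where
  "tangent_space M x =
     {v. \<exists>e c. e > 0 \<and> smooth_on {-e<..<e} c \<and> (\<forall>t\<in>{-e<..<e}. c t \<in> M) \<and>
         c (0::real) = x \<and> (c has_vector_derivative v) (at 0)}"

text \<open>A one-form assigns to a point \<open>x\<close> a linear functional of the tangent vector \<open>v\<close>.\<close>

type_synonym 'a one_form = "'a \<Rightarrow> 'a \<Rightarrow> real"

definition differential :: "('a::euclidean_space \<Rightarrow> real) \<Rightarrow> 'a one_form" where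
  "differential f = (\<lambda>x v. frechet_derivative f (at x) v)"

definition pullback ::
  "('a::euclidean_space \<Rightarrow> 'b::euclidean_space) \<Rightarrow> 'b one_form \<Rightarrow> 'a one_form" where
  "pullback F \<omega> = (\<lambda>x v. \<omega> (F x) (frechet_derivative F (at x) v))"

definition exterior_derivative :: "'a::euclidean_space one_form \<Rightarrow> 'a \<Rightarrow> 'a \<Rightarrow> 'a \<Rightarrow> real" where
  "exterior_derivative \<omega> x u v =
     frechet_derivative (\<lambda>y. \<omega> y v) (at x) u - frechet_derivative (\<lambda>y. \<omega> y u) (at x) v"

definition vanishes_on :: "'a::euclidean_space one_form \<Rightarrow> 'a set \<Rightarrow> bool" where
  "vanishes_on \<omega> M \<longleftrightarrow> (\<forall>x\<in>M. \<forall>v\<in>tangent_space M x. \<omega> x v = 0)"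

text \<open>A contact form: a nowhere vanishing smooth one-form whose exterior derivative is
  nondegenerate on its kernel.\<close>

definition contact_form :: "'a::euclidean_space one_form \<Rightarrow> bool" where
  "contact_form \<omega> \<longleftrightarrow>
     (\<forall>x. linear (\<omega> x)) \<and> (\<forall>v. smooth_on UNIV (\<lambda>x. \<omega> x v)) \<and>
     (\<forall>x. \<exists>v. \<omega> x v \<noteq> 0) \<and>
     (\<forall>x u. \<omega> x u = 0 \<and> u \<noteq> 0 \<longrightarrow> (\<exists>v. \<omega> x v = 0 \<and> exterior_derivative \<omega> x u v \<noteq> 0))"


subsection \<open>Entropy maximization\<close>

text \<open>The relative entropy \<open>- (\<Sum>x. P x log P x - P x log Q x)\<close>, with \<open>0 log 0 = 0\<close>.
  Since \<open>p log p - p log q \<ge> p - q\<close>, the negative parts of the summands always have a finite sum.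
  So the value is \<open>-\<infinity>\<close> exactly when \<open>P x > 0 = Q x\<close> for some \<open>x\<close> or the series is not summable.\<close>

definition relative_entropy :: "'x pmf \<Rightarrow> 'x pmf \<Rightarrow> ereal" where
  "relative_entropy P Q =
     (if set_pmf P \<subseteq> set_pmf Q \<and>
         (\<lambda>x. pmf P x * ln (pmf P x) - pmf P x * ln (pmf Q x)) summable_on UNIV
      then ereal (- (\<Sum>\<^sub>\<infinity>x. pmf P x * ln (pmf P x) - pmf P x * ln (pmf Q x)))
      else -\<infinity>)"

definition satisfies_constraints ::
  "('m::finite \<Rightarrow> 'x \<Rightarrow> real) \<Rightarrow> real^'m \<Rightarrow> 'x pmf \<Rightarrow> bool" where
  "satisfies_constraints Ahat A P \<longleftrightarrow>
     (\<forall>i. ((\<lambda>x. pmf P x * Ahat i x) has_sum (A $ i)) UNIV)"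

definition entropy_maximizer ::
  "'x pmf \<Rightarrow> ('m::finite \<Rightarrow> 'x \<Rightarrow> real) \<Rightarrow> real^'m \<Rightarrow> 'x pmf \<Rightarrow> bool" where
  "entropy_maximizer Q Ahat A P \<longleftrightarrow>
     satisfies_constraints Ahat A P \<and>
     (\<forall>P'. satisfies_constraints Ahat A P' \<longrightarrow> relative_entropy P' Q \<le> relative_entropy P Q)"

text \<open>The Lagrangian, with multiplier \<open>\<mu>\<close> for the normalization and \<open>a $ i\<close> for the \<open>i\<close>-th
  expected-value constraint.\<close>

definition lagrangian ::
  "'x pmf \<Rightarrow> ('m::finite \<Rightarrow> 'x \<Rightarrow> real) \<Rightarrow> real^'m \<Rightarrow> real \<Rightarrow> real^'m \<Rightarrow> ('x \<Rightarrow> real) \<Rightarrow> real" where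
  "lagrangian Q Ahat A \<mu> a f =
     - (\<Sum>\<^sub>\<infinity>x. f x * ln (f x) - f x * ln (pmf Q x))
     - \<mu> * ((\<Sum>\<^sub>\<infinity>x. f x) - 1)
     - (\<Sum>i\<in>UNIV. a $ i * ((\<Sum>\<^sub>\<infinity>x. f x * Ahat i x) - A $ i))"

text \<open>Stationarity of the Lagrangian in each variable \<open>P x\<close>. Only \<open>x\<close> in the support of \<open>Q\<close>
  is varied: elsewhere \<open>P x = 0\<close> is forced by finiteness of the entropy.\<close>

definition lagrange_multipliers ::
  "'x pmf \<Rightarrow> ('m::finite \<Rightarrow> 'x \<Rightarrow> real) \<Rightarrow> real^'m \<Rightarrow> 'x pmf \<Rightarrow> real^'m \<Rightarrow> bool" where
  "lagrange_multipliers Q Ahat A P a \<longleftrightarrow>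
     (\<exists>\<mu>. \<forall>x\<in>set_pmf Q.
        ((\<lambda>t. lagrangian Q Ahat A \<mu> a ((pmf P)(x := t))) has_real_derivative 0) (at (pmf P x)))"

definition gibbs_weight ::
  "'x pmf \<Rightarrow> ('m::finite \<Rightarrow> 'x \<Rightarrow> real) \<Rightarrow> real^'m \<Rightarrow> 'x \<Rightarrow> real" where
  "gibbs_weight Q Ahat a x = pmf Q x * exp (- (\<Sum>i\<in>UNIV. a $ i * Ahat i x))"

definition partition_function ::
  "'x pmf \<Rightarrow> ('m::finite \<Rightarrow> 'x \<Rightarrow> real) \<Rightarrow> real^'m \<Rightarrow> real" where
  "partition_function Q Ahat a = (\<Sum>\<^sub>\<infinity>x. gibbs_weight Q Ahat a x)"


subsection \<open>The contact form and the Legendre transformations\<close>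

text \<open>A point is \<open>(q\<^sub>0, (q\<^sub>i)\<^sub>i, (p\<^sub>i)\<^sub>i)\<close>; the index type \<open>'m\<close> has \<open>m\<close> elements.\<close>

type_synonym 'm phase_space = "real \<times> (real^'m) \<times> (real^'m)"

definition q0 :: "'m::finite phase_space \<Rightarrow> real" where
  "q0 z = fst z"

definition qc :: "'m::finite \<Rightarrow> 'm phase_space \<Rightarrow> real" where
  "qc i z = fst (snd z) $ i"

definition pc :: "'m::finite \<Rightarrow> 'm phase_space \<Rightarrow> real" where
  "pc i z = snd (snd z) $ i"

definition omega_cl :: "'m::finite phase_space one_form" where
  "omega_cl = (\<lambda>z v. differential q0 z v - (\<Sum>i\<in>UNIV. pc i z * differential (qc i) z v))"

definition state_manifold ::
  "(real^'m) set \<Rightarrow> (real^'m \<Rightarrow> real) \<Rightarrow> (real^'m \<Rightarrow> real^'m) \<Rightarrow> 'm::finite phase_space set" where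
  "state_manifold U S \<alpha> =
     {z. \<exists>A\<in>U. (\<forall>i. qc i z = A $ i) \<and> q0 z = S A \<and> (\<forall>i. pc i z = \<alpha> A $ i)}"

text \<open>The coordinates are numbered \<open>1, \<dots>, m\<close> by \<open>idx\<close>; the first \<open>l\<close> pairs are exchanged.\<close>

definition legendre :: "(nat \<Rightarrow> 'm) \<Rightarrow> nat \<Rightarrow> 'm::finite phase_space \<Rightarrow> 'm phase_space" where
  "legendre idx l z =
     (q0 z - (\<Sum>j=1..l. pc (idx j) z * qc (idx j) z),
      (\<chi> i. if i \<in> idx ` {1..l} then pc i z else qc i z),
      (\<chi> i. if i \<in> idx ` {1..l} then - qc i z else pc i z))"

end

(* Stationarity of the Lagrangian forces P = e^c Q e^(- alpha . Ahat) and hence S(A) = alpha(A) . A - c.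
   Gibbs' inequality compares the maximizers at two points A and B of U and gives
     S(B) <= S(A) + alpha(A) . (B - A).
   Exchanging A and B squeezes S(B) - S(A) between alpha(B) . (B - A) and alpha(A) . (B - A), so that
   continuity of alpha alone makes alpha the gradient of S; the partition function is never
   differentiated.  The submanifold is the graph of (S, alpha), straightened by the shear
   (q0, q, p) |-> (q0 - S(q), q, p - alpha(q)). *)

theory Submission
  imports Defs
begin

subsection \<open>Smooth maps\<close>

text \<open>Derivatives depend on values in a neighbourhood, so equality on a set passes to the
  derivatives only when the set is open. The induction runs over all pairs \<open>f\<close>,
  \<open>g\<close> because it descends to their directional derivatives.\<close>

lemma Ck_on_cong:
  assumes "open U"
  shows "Ck_on n U f \<Longrightarrow> (\<And>x. x \<in> U \<Longrightarrow> f x = g x) \<Longrightarrow> Ck_on n U g"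
proof (induction n arbitrary: f g)
  case 0
  then show ?case by (simp cong: continuous_on_cong)
next
  case (Suc n)
  have f: "f differentiable (at x)" if "x \<in> U" for x
    using Suc.prems(1) that by simp
  have "frechet_derivative f (at x) = frechet_derivative g (at x)" if "x \<in> U" for x
    by (rule frechet_derivative_transform_within_open[OF f[OF that] assms that Suc.prems(2)])
  then have "Ck_on n U (\<lambda>x. frechet_derivative g (at x) v)" for v
    using Suc.IH[of "\<lambda>x. frechet_derivative f (at x) v"] Suc.prems(1) by simp
  moreover have "g differentiable (at x)" if "x \<in> U" for x
  proof -
    obtain D where "(f has_derivative D) (at x)"
      using f[OF \<open>x \<in> U\<close>] by (auto simp: differentiable_def)
    then have "(g has_derivative D) (at x)"
      using assms that Suc.prems(2) by (rule has_derivative_transform_within_open)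
    then show ?thesis
      by (auto simp: differentiable_def)
  qed
  ultimately show ?case by simp
qed

text \<open>Uniqueness of derivatives identifies any explicit \<open>f'\<close> with the chosen
  \<open>frechet_derivative\<close> on \<open>U\<close>, so later proofs can work with
  formulas.\<close>

lemma Ck_on_SucI:
  assumes "open U" and f': "\<And>x. x \<in> U \<Longrightarrow> (f has_derivative f' x) (at x)"
    and "\<And>v. Ck_on n U (\<lambda>x. f' x v)"
  shows "Ck_on (Suc n) U f"
proof -
  have "f' x v = frechet_derivative f (at x) v" if "x \<in> U" for x v
    using frechet_derivative_at[OF f'[OF that]] by simp
  then have "Ck_on n U (\<lambda>x. frechet_derivative f (at x) v)" for v
    by (rule Ck_on_cong[OF assms(1,3)])
  then show ?thesis
    using f' by (auto simp: differentiable_def)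
qed

lemma Ck_on_SucD:
  assumes "Ck_on (Suc n) U f"
  shows "x \<in> U \<Longrightarrow> (f has_derivative frechet_derivative f (at x)) (at x)"
    and "Ck_on n U (\<lambda>x. frechet_derivative f (at x) v)"
  using assms by (auto simp: frechet_derivative_works[symmetric])

lemma smooth_on_cong:
  assumes "open U" "smooth_on U f" "\<And>x. x \<in> U \<Longrightarrow> f x = g x"
  shows "smooth_on U g"
  using assms Ck_on_cong unfolding smooth_on_def by blast

lemma smooth_on_const: "smooth_on U (\<lambda>_. c)"
proof -
  have "Ck_on n U (\<lambda>_. c)" for n
    by (induction n arbitrary: c) auto
  then show ?thesis by (simp add: smooth_on_def)
qed

lemma smooth_onI:
  assumes "open U" "\<And>x. x \<in> U \<Longrightarrow> (f has_derivative f' x) (at x)"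
    and "\<And>v. smooth_on U (\<lambda>x. f' x v)"
  shows "smooth_on U f"
  unfolding smooth_on_def
proof
  fix n show "Ck_on n U f"
  proof (cases n)
    case 0
    then show ?thesis
      using assms(2) by (auto intro!: continuous_at_imp_continuous_on has_derivative_continuous)
  next
    case (Suc k)
    then show ?thesis
      using assms Ck_on_SucI[OF assms(1,2), of k] by (simp add: smooth_on_def)
  qed
qed

lemma smooth_on_bounded_linear:
  assumes "open U" "bounded_linear f"
  shows "smooth_on U f"
  using assms(1) bounded_linear_imp_has_derivative[OF assms(2)] smooth_on_const
  by (rule smooth_onI)

text \<open>Differentiating along \<open>v\<close> gives \<open>h\<close> applied to the directional
  derivative of \<open>f\<close>: the shape is preserved, so the induction closes.\<close>

lemma smooth_on_compose_left:
  assumes "open U" "bounded_linear h" "smooth_on U f"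
  shows "smooth_on U (\<lambda>x. h (f x))"
proof -
  have "Ck_on n U f \<Longrightarrow> Ck_on n U (\<lambda>x. h (f x))" for n
  proof (induction n arbitrary: f)
    case 0
    then show ?case
      using bounded_linear.continuous_on[OF assms(2)] by simp
  next
    case (Suc n)
    show ?case
      using assms(1) bounded_linear.has_derivative[OF assms(2) Ck_on_SucD(1)[OF Suc.prems]]
        Suc.IH[OF Ck_on_SucD(2)[OF Suc.prems]]
      by (rule Ck_on_SucI)
  qed
  then show ?thesis
    using assms(3) by (simp add: smooth_on_def)
qed

text \<open>The derivative along \<open>v\<close> is the derivative of \<open>f\<close> along the
  fixed vector \<open>h v\<close>, again composed with \<open>h\<close>; the induction therefore
  stays within one shape.\<close>

lemma smooth_on_compose_right:
  assumes "open U" "bounded_linear h" "\<And>x. x \<in> U \<Longrightarrow> h x \<in> V" "smooth_on V f"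
  shows "smooth_on U (\<lambda>x. f (h x))"
proof -
  have "Ck_on n V f \<Longrightarrow> Ck_on n U (\<lambda>x. f (h x))" for n
  proof (induction n arbitrary: f)
    case 0
    then show ?case
      using assms(3) bounded_linear.continuous_on[OF assms(2) continuous_on_id]
      by (auto intro: continuous_on_compose2)
  next
    case (Suc n)
    have "((\<lambda>x. f (h x)) has_derivative (\<lambda>v. frechet_derivative f (at (h x)) (h v))) (at x)"
      if "x \<in> U" for x
      using bounded_linear_imp_has_derivative[OF assms(2)] Ck_on_SucD(1)[OF Suc.prems assms(3)[OF that]]
      by (rule has_derivative_compose)
    then show ?case
      using assms(1) Suc.IH[OF Ck_on_SucD(2)[OF Suc.prems]] by (intro Ck_on_SucI)
  qed
  then show ?thesis
    using assms(4) by (simp add: smooth_on_def)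
qed

lemma smooth_on_add:
  assumes "open U" "smooth_on U f" "smooth_on U g"
  shows "smooth_on U (\<lambda>x. f x + g x)"
proof -
  have "Ck_on n U f \<Longrightarrow> Ck_on n U g \<Longrightarrow> Ck_on n U (\<lambda>x. f x + g x)" for n
  proof (induction n arbitrary: f g)
    case 0
    then show ?case by (simp add: continuous_on_add)
  next
    case (Suc n)
    show ?case
      using assms(1) has_derivative_add[OF Ck_on_SucD(1)[OF Suc.prems(1)] Ck_on_SucD(1)[OF Suc.prems(2)]]
        Suc.IH[OF Ck_on_SucD(2)[OF Suc.prems(1)] Ck_on_SucD(2)[OF Suc.prems(2)]]
      by (rule Ck_on_SucI)
  qed
  then show ?thesis
    using assms by (simp add: smooth_on_def)
qed

lemma smooth_on_sum:
  assumes "open U" "\<And>i. i \<in> I \<Longrightarrow> smooth_on U (f i)"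
  shows "smooth_on U (\<lambda>x. \<Sum>i\<in>I. f i x)"
  using assms(2)
  by (induction I rule: infinite_finite_induct) (auto intro: smooth_on_const smooth_on_add assms(1))

text \<open>In a fixed direction the derivative of a product of two linear functions is linear in
  the base point, hence smooth. This covers the terms \<open>p_i q_i\<close> of the Legendre
  transformation.\<close>

lemma smooth_on_linear_mult:
  fixes f g :: "'a::euclidean_space \<Rightarrow> real"
  assumes "open U" "bounded_linear f" "bounded_linear g"
  shows "smooth_on U (\<lambda>x. f x * g x)"
proof (rule smooth_onI[OF assms(1)])
  show "((\<lambda>x. f x * g x) has_derivative (\<lambda>v. f x * g v + f v * g x)) (at x)" for x
    using assms(2,3) by (intro has_derivative_mult bounded_linear_imp_has_derivative)
  show "smooth_on U (\<lambda>x. f x * g v + f v * g x)" for v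
    using assms
    by (intro smooth_on_bounded_linear bounded_linear_add bounded_linear_mult_const bounded_linear_const_mult)
qed

text \<open>An explicit inverse \<open>G\<close> agrees with \<open>inv_into W F\<close> on the open
  set \<open>W'\<close>, so its smoothness carries over.\<close>

lemma diffeomorphismI:
  assumes "open W" "open W'" "smooth_on W F" "smooth_on W' G"
    and W: "\<And>x. x \<in> W \<Longrightarrow> F x \<in> W' \<and> G (F x) = x"
    and W': "\<And>y. y \<in> W' \<Longrightarrow> G y \<in> W \<and> F (G y) = y"
  shows "diffeomorphism W W' F"
proof -
  have bij: "bij_betw F W W'"
    using W W' by (intro bij_betwI[of _ _ _ G]) auto
  have "G y = inv_into W F y" if "y \<in> W'" for y
    using inv_into_f_f[OF bij_betw_imp_inj_on[OF bij], of "G y"] W'[OF that] by simp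
  then have "smooth_on W' (inv_into W F)"
    using smooth_on_cong[OF assms(2,4)] by blast
  then show ?thesis
    using assms bij by (simp add: diffeomorphism_def)
qed

subsection \<open>The contact form\<close>

lemma bounded_linear_coordinates:
  shows bounded_linear_q0: "bounded_linear q0"
    and bounded_linear_qc: "bounded_linear (qc i)"
    and bounded_linear_pc: "bounded_linear (pc i)"
  unfolding q0_def qc_def pc_def
  by (intro bounded_linear_fst bounded_linear_snd bounded_linear_compose[OF bounded_linear_vec_nth]
      bounded_linear_fst_comp bounded_linear_snd_comp)+

lemma differential_bounded_linear:
  assumes "bounded_linear f"
  shows "differential f x v = f v"
  using frechet_derivative_at[OF bounded_linear_imp_has_derivative[OF assms], of x]
  by (simp add: differential_def)

text \<open>The coordinates are linear, so each is its own differential. This form serves the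
  coordinatewise Legendre computation, the inner-product form below the vector arguments.\<close>

lemma omega_cl_eq_sum: "omega_cl z v = q0 v - (\<Sum>i\<in>UNIV. pc i z * qc i v)"
  by (simp add: omega_cl_def differential_bounded_linear bounded_linear_coordinates)

lemma omega_cl_eq_inner: "omega_cl z v = fst v - snd (snd z) \<bullet> fst (snd v)"
  by (simp add: omega_cl_eq_sum q0_def pc_def qc_def inner_vec_def)

text \<open>This is the canonical two-form, the sum of the \<open>dq_i \<and> dp_i\<close>; it is
  constant in \<open>z\<close> because \<omega> is affine in the base point.\<close>

lemma exterior_derivative_omega_cl:
  "exterior_derivative omega_cl z u v = snd (snd v) \<bullet> fst (snd u) - snd (snd u) \<bullet> fst (snd v)"
proof -
  have "((\<lambda>y. omega_cl y v) has_derivative (\<lambda>u. - (snd (snd u) \<bullet> fst (snd v)))) (at z)" for v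
    unfolding omega_cl_eq_inner by (auto intro!: derivative_eq_intros)
  from frechet_derivative_at[OF this, symmetric] show ?thesis
    by (simp add: exterior_derivative_def)
qed

lemma contact_form_omega_cl: "contact_form (omega_cl :: 'm::finite phase_space one_form)"
  unfolding contact_form_def
proof (intro conjI allI impI)
  show "linear (omega_cl z)" for z :: "'m phase_space"
    by (rule linearI) (simp_all add: omega_cl_eq_inner algebra_simps)
  show "smooth_on UNIV (\<lambda>z. omega_cl z v)" for v :: "'m phase_space"
  proof -
    have "bounded_linear (\<lambda>z::'m phase_space. - (snd (snd z) \<bullet> fst (snd v)))"
      by (intro bounded_linear_minus bounded_linear_inner_left_comp bounded_linear_snd_comp
          bounded_linear_snd)
    from smooth_on_add[OF open_UNIV smooth_on_const[of _ "fst v"]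
        smooth_on_bounded_linear[OF open_UNIV this]]
    show ?thesis by (simp add: omega_cl_eq_inner)
  qed
  show "\<exists>v. omega_cl z v \<noteq> 0" for z :: "'m phase_space"
    by (rule exI[of _ "(1, 0, 0)"]) (simp add: omega_cl_eq_inner)
  fix z u :: "'m phase_space"
  assume u: "omega_cl z u = 0 \<and> u \<noteq> 0"
  obtain s a b where s: "u = (s, a, b)"
    by (metis prod.exhaust)
  show "\<exists>v. omega_cl z v = 0 \<and> exterior_derivative omega_cl z u v \<noteq> 0"
  proof (cases "a = 0")
    case False
    \<comment> \<open>A pure \<open>p\<close> direction lies in the kernel, and pairing it with
      \<open>u\<close> gives \<open>a \<bullet> a\<close>.\<close>
    then show ?thesis
      by (intro exI[of _ "(0, 0, a)"])
        (simp add: s omega_cl_eq_inner exterior_derivative_omega_cl)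
  next
    case True
    \<comment> \<open>With \<open>a = 0\<close> the kernel condition forces \<open>s = 0\<close>, so
      only \<open>b\<close> can be nonzero.\<close>
    then have "b \<noteq> 0"
      using u by (auto simp: s omega_cl_eq_inner zero_prod_def)
    \<comment> \<open>The first component is chosen to put the vector into the kernel; the pairing
      is then \<open>- (b \<bullet> b)\<close>.\<close>
    then show ?thesis
      by (intro exI[of _ "(snd (snd z) \<bullet> b, b, 0)"])
        (simp add: s omega_cl_eq_inner exterior_derivative_omega_cl)
  qed
qed

section \<open>The submanifold of maximizers as a graph\<close>

lemma state_manifold_eq: "state_manifold U S \<alpha> = (\<lambda>A. (S A, A, \<alpha> A)) ` U"
proof -
  have "(\<forall>i. qc i z = A $ i) \<longleftrightarrow> fst (snd z) = A" "(\<forall>i. pc i z = \<alpha> A $ i) \<longleftrightarrow> snd (snd z) = \<alpha> A" for z A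
    by (simp_all add: qc_def pc_def vec_eq_iff)
  then have "state_manifold U S \<alpha> = {z. \<exists>A\<in>U. fst (snd z) = A \<and> fst z = S A \<and> snd (snd z) = \<alpha> A}"
    by (simp add: state_manifold_def q0_def)
  then show ?thesis by force
qed

lemma submanifold_state_manifold:
  fixes S :: "real^'m::finite \<Rightarrow> real"
  assumes "open U" "smooth_on U S" "smooth_on U \<alpha>"
  shows "submanifold CARD('m) (state_manifold U S \<alpha>)"
proof -
  let ?W = "(UNIV :: real set) \<times> U \<times> (UNIV :: (real^'m) set)"
  let ?L = "{0::real} \<times> UNIV \<times> {0} :: 'm phase_space set"
  \<comment> \<open>The scalar \<open>c\<close> covers the shear (\<open>c = - 1\<close>) and its
    inverse (\<open>c = 1\<close>) by one formula; they cancel because \<open>q\<close> stays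
    fixed.\<close>
  define F where "F c z = z + c *\<^sub>R (S (fst (snd z)), 0, \<alpha> (fst (snd z)))" for c :: real and z
  have W: "open ?W"
    using assms(1) by (intro open_Times) auto
  have F: "smooth_on ?W (F c)" for c
  proof -
    have q: "bounded_linear (\<lambda>z::'m phase_space. fst (snd z))"
      by (intro bounded_linear_fst_comp bounded_linear_snd)
    have "smooth_on ?W (\<lambda>z. z + ((c * S (fst (snd z)), 0, 0) + (0, 0, c *\<^sub>R \<alpha> (fst (snd z)))))"
    proof (intro smooth_on_add W)
      show "smooth_on ?W (\<lambda>z. z)"
        by (intro smooth_on_bounded_linear W bounded_linear_ident)
      have "bounded_linear (\<lambda>s::real. (c * s, 0, 0) :: 'm phase_space)"
        by (intro bounded_linear_Pair bounded_linear_mult_right bounded_linear_zero)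
      moreover have "smooth_on ?W (\<lambda>z. S (fst (snd z)))"
        by (rule smooth_on_compose_right[OF W q _ assms(2)]) auto
      ultimately show "smooth_on ?W (\<lambda>z. (c * S (fst (snd z)), 0, 0) :: 'm phase_space)"
        by (rule smooth_on_compose_left[OF W])
      have "bounded_linear (\<lambda>a::real^'m. (0, 0, c *\<^sub>R a) :: 'm phase_space)"
        by (intro bounded_linear_Pair bounded_linear_scaleR_right bounded_linear_zero)
      moreover have "smooth_on ?W (\<lambda>z. \<alpha> (fst (snd z)))"
        by (rule smooth_on_compose_right[OF W q _ assms(3)]) auto
      ultimately show "smooth_on ?W (\<lambda>z. (0, 0, c *\<^sub>R \<alpha> (fst (snd z))) :: 'm phase_space)"
        by (rule smooth_on_compose_left[OF W])
    qed
    then show ?thesis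
      by (rule smooth_on_cong[OF W]) (simp add: F_def)
  qed
  have diffeo: "diffeomorphism ?W ?W (F (- 1))"
    by (rule diffeomorphismI[OF W W F F[of 1]]) (auto simp: F_def prod_eq_iff)
  have sub: "subspace ?L"
    by (auto simp: subspace_def zero_prod_def)
  have dim: "dim ?L = CARD('m)"
  proof -
    have "dim ?L = dim {0::real} + dim (UNIV \<times> {0} :: ((real^'m) \<times> (real^'m)) set)"
      by (intro dim_Times subspace_Times subspace_UNIV subspace_single_0)
    also have "dim (UNIV \<times> {0} :: ((real^'m) \<times> (real^'m)) set) = dim (UNIV :: (real^'m) set) + dim {0::real^'m}"
      by (intro dim_Times subspace_Times subspace_UNIV subspace_single_0)
    finally show ?thesis by simp
  qed
  have M: "state_manifold U S \<alpha> \<subseteq> ?W"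
    by (auto simp: state_manifold_eq)
  then have "F (- 1) ` (state_manifold U S \<alpha> \<inter> ?W) = F (- 1) ` state_manifold U S \<alpha>"
    by (simp add: Int_absorb2)
  also have "\<dots> = (\<lambda>A. (0, A, 0)) ` U"
    by (simp add: state_manifold_eq image_image F_def)
  also have "\<dots> = ?W \<inter> ?L"
    by auto
  finally have image: "F (- 1) ` (state_manifold U S \<alpha> \<inter> ?W) = ?W \<inter> ?L" .
  show ?thesis
    unfolding submanifold_def using diffeo sub dim image M by blast
qed

text \<open>Along a curve in the graph, \<open>q0\<close> equals \<open>S\<close> of the
  \<open>q\<close> part. Differentiating this identity at 0 by the chain rule gives exactly the
  vanishing of \<omega> on the velocity.\<close>

lemma vanishes_on_state_manifold:
  assumes S: "\<And>A. A \<in> U \<Longrightarrow> (S has_derivative (\<lambda>v. \<alpha> A \<bullet> v)) (at A)"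
  shows "vanishes_on omega_cl (state_manifold U S \<alpha>)"
  unfolding vanishes_on_def
proof (intro ballI)
  fix z v assume z: "z \<in> state_manifold U S \<alpha>" and "v \<in> tangent_space (state_manifold U S \<alpha>) z"
  then obtain e c where e: "e > 0" and c: "\<And>t. t \<in> {-e<..<e} \<Longrightarrow> c t \<in> state_manifold U S \<alpha>"
    and c0: "c (0::real) = z" and v: "(c has_vector_derivative v) (at 0)"
    unfolding tangent_space_def by blast
  let ?q = "\<lambda>t. fst (snd (c t))"
  have c': "((\<lambda>t. fst (c t)) has_derivative (\<lambda>t. t *\<^sub>R fst v)) (at 0)"
    "(?q has_derivative (\<lambda>t. t *\<^sub>R fst (snd v))) (at 0)"
    using v unfolding has_vector_derivative_def
    by (auto intro!: derivative_eq_intros)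
  have z': "?q 0 \<in> U" "snd (snd z) = \<alpha> (?q 0)"
    using z c0 by (auto simp: state_manifold_eq)
  have "((\<lambda>t. S (?q t)) has_derivative (\<lambda>t. \<alpha> (?q 0) \<bullet> (t *\<^sub>R fst (snd v)))) (at 0)"
    using c'(2) S[OF z'(1)] by (rule has_derivative_compose)
  then have "((\<lambda>t. fst (c t)) has_derivative (\<lambda>t. \<alpha> (?q 0) \<bullet> (t *\<^sub>R fst (snd v)))) (at 0)"
  proof (rule has_derivative_transform_within_open)
    show "open {-e<..<e}" "0 \<in> {-e<..<e}"
      using e by auto
    show "S (?q t) = fst (c t)" if "t \<in> {-e<..<e}" for t
      using c[OF that] by (auto simp: state_manifold_eq)
  qed
  \<comment> \<open>Two derivatives of the \<open>q0\<close> component coincide as linear maps of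
    the time increment; their values at 1 are the two terms of \<omega>.\<close>
  from fun_cong[OF has_derivative_unique[OF c'(1) this], of 1]
  show "omega_cl z v = 0"
    by (simp add: omega_cl_eq_inner z'(2))
qed

section \<open>Legendre transformations\<close>

text \<open>Separates a linear change of coordinates from the quadratic correction of
  \<open>q0\<close>, so that differentiation and smoothness can be treated for arbitrary linear
  \<open>L\<close>.\<close>

definition quadratic_shift ::
  "('m phase_space \<Rightarrow> 'm phase_space) \<Rightarrow> 'm set \<Rightarrow> 'm::finite phase_space \<Rightarrow> 'm phase_space" where
  "quadratic_shift L I z = L z + (- (\<Sum>i\<in>I. pc i z * qc i z), 0, 0)"

lemma has_derivative_quadratic_shift:
  assumes "bounded_linear L"
  shows "(quadratic_shift L I has_derivative
    (\<lambda>v. L v + (- (\<Sum>i\<in>I. pc i z * qc i v + pc i v * qc i z), 0, 0))) (at z)"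
  unfolding quadratic_shift_def
  by (intro has_derivative_add has_derivative_Pair has_derivative_minus has_derivative_sum
      has_derivative_mult has_derivative_const bounded_linear_imp_has_derivative
      bounded_linear_coordinates assms)

lemma smooth_on_quadratic_shift:
  fixes L :: "'m::finite phase_space \<Rightarrow> 'm phase_space"
  assumes "bounded_linear L"
  shows "smooth_on UNIV (quadratic_shift L I)"
proof -
  have "bounded_linear (\<lambda>s::real. (- s, 0, 0) :: 'm phase_space)"
    by (intro bounded_linear_Pair bounded_linear_minus bounded_linear_ident bounded_linear_zero)
  then show ?thesis
    unfolding quadratic_shift_def
    by (intro smooth_on_add smooth_on_bounded_linear open_UNIV assms
        smooth_on_compose_left[of _ "\<lambda>s. (- s, 0, 0)"] smooth_on_sum smooth_on_linear_mult
        bounded_linear_coordinates)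
qed

text \<open>For \<open>s = 1\<close> and \<open>s = - 1\<close> these are quarter turns in opposite
  senses in the \<open>(q_i, p_i)\<close> planes with \<open>i \<in> I\<close>.\<close>

definition partial_rotation ::
  "real \<Rightarrow> 'm set \<Rightarrow> 'm::finite phase_space \<Rightarrow> 'm phase_space" where
  "partial_rotation s I z =
     (q0 z, (\<chi> i. if i \<in> I then s * pc i z else qc i z), (\<chi> i. if i \<in> I then - s * qc i z else pc i z))"

lemma bounded_linear_partial_rotation: "bounded_linear (partial_rotation s I)"
  unfolding linear_conv_bounded_linear[symmetric]
  by (rule linearI)
    (auto simp: partial_rotation_def q0_def qc_def pc_def vec_eq_iff algebra_simps)

text \<open>Injectivity of the numbering turns the sum over positions \<open>j\<close> into a sum
  over the set of exchanged indices, each counted once.\<close>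

lemma legendre_eq:
  assumes "inj_on idx {1..l}"
  shows "legendre idx l = quadratic_shift (partial_rotation 1 (idx ` {1..l})) (idx ` {1..l})"
proof
  fix z
  have "(\<Sum>i\<in>idx ` {1..l}. pc i z * qc i z) = (\<Sum>j=1..l. pc (idx j) z * qc (idx j) z)"
    by (simp only: sum.reindex[OF assms] o_def)
  then show "legendre idx l z = quadratic_shift (partial_rotation 1 (idx ` {1..l})) (idx ` {1..l}) z"
    by (simp add: legendre_def quadratic_shift_def partial_rotation_def cong: if_cong)
qed

lemma coordinates_quadratic_shift_partial_rotation:
  fixes s :: real and I :: "'m::finite set"
  defines "F \<equiv> quadratic_shift (partial_rotation s I) I"
  shows "q0 (F z) = q0 z - (\<Sum>i\<in>I. pc i z * qc i z)"
    and "qc i (F z) = (if i \<in> I then s * pc i z else qc i z)"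
    and "pc i (F z) = (if i \<in> I then - s * qc i z else pc i z)"
  by (simp_all add: F_def quadratic_shift_def partial_rotation_def q0_def qc_def pc_def)

lemma phase_space_eqI:
  assumes "q0 z = q0 w" "\<And>i. qc i z = qc i w" "\<And>i. pc i z = pc i w"
  shows "z = w"
  using assms by (auto simp: q0_def qc_def pc_def vec_eq_iff prod_eq_iff)

(* p_i q_i changes sign under (q_i, p_i) |-> (s p_i, - s q_i), so one and the same quadratic term serves
   the Legendre transformation (s = 1) and its inverse (s = - 1). *)
lemma quadratic_shift_partial_rotation_inverse:
  assumes "s * s = 1"
  shows "quadratic_shift (partial_rotation (- s) I) I (quadratic_shift (partial_rotation s I) I z) = z"
proof (rule phase_space_eqI)
  let ?F = "\<lambda>s. quadratic_shift (partial_rotation s I) I"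
  have cancel: "s * (s * x) = x" for x
    using assms by (simp flip: mult.assoc)
  have "(\<Sum>i\<in>I. pc i (?F s z) * qc i (?F s z)) = (\<Sum>i\<in>I. - (pc i z * qc i z))"
    by (intro sum.cong)
      (simp_all add: coordinates_quadratic_shift_partial_rotation cancel mult.left_commute mult.commute)
  then show "q0 (?F (- s) (?F s z)) = q0 z"
    by (simp add: coordinates_quadratic_shift_partial_rotation(1) sum_negf)
  show "qc i (?F (- s) (?F s z)) = qc i z" "pc i (?F (- s) (?F s z)) = pc i z" for i
    by (simp_all add: coordinates_quadratic_shift_partial_rotation(2,3) cancel)
qed

lemma diffeomorphism_legendre:
  assumes "inj_on idx {1..l}"
  shows "diffeomorphism UNIV UNIV (legendre idx l)"
proof -
  let ?F = "\<lambda>s. quadratic_shift (partial_rotation s (idx ` {1..l})) (idx ` {1..l})"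
  have smooth: "smooth_on UNIV (?F s)" for s
    by (rule smooth_on_quadratic_shift[OF bounded_linear_partial_rotation])
  have "diffeomorphism UNIV UNIV (?F 1)"
    using quadratic_shift_partial_rotation_inverse[of 1] quadratic_shift_partial_rotation_inverse[of "- 1"]
    by (intro diffeomorphismI[OF _ _ smooth smooth[of "- 1"]]) auto
  then show ?thesis
    by (simp only: legendre_eq[OF assms])
qed

text \<open>For an exchanged index, \<open>p_i dq_i\<close> becomes
  \<open>- q_i dp_i = p_i dq_i - d(p_i q_i)\<close>, while \<open>dq_0\<close> loses the same
  \<open>d(p_i q_i)\<close>. The two changes cancel in \<omega>.\<close>

lemma pullback_legendre_omega_cl:
  fixes idx :: "nat \<Rightarrow> 'm::finite"
  assumes "inj_on idx {1..l}"
  shows "pullback (legendre idx l) omega_cl = omega_cl"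
proof (intro ext)
  fix z v :: "'m phase_space"
  let ?I = "idx ` {1..l}"
  let ?R = "partial_rotation 1 ?I"
  let ?D = "?R v + (- (\<Sum>i\<in>?I. pc i z * qc i v + pc i v * qc i z), 0, 0)"
  have D: "frechet_derivative (legendre idx l) (at z) v = ?D"
    using fun_cong[OF frechet_derivative_at[OF has_derivative_quadratic_shift[
          OF bounded_linear_partial_rotation, of 1 ?I ?I z]], of v]
    by (simp only: legendre_eq[OF assms])
  have q0: "q0 ?D = q0 v - (\<Sum>i\<in>?I. pc i z * qc i v + pc i v * qc i z)"
    by (simp add: partial_rotation_def q0_def)
  \<comment> \<open>One formula for all \<open>i\<close>, with the correction restricted by
    \<open>if\<close>, lets the full sum split off a sum over \<open>?I\<close>.\<close>
  have "pc i (legendre idx l z) * qc i ?D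
      = pc i z * qc i v - (if i \<in> ?I then pc i z * qc i v + pc i v * qc i z else 0)" for i
    by (simp add: legendre_eq[OF assms] coordinates_quadratic_shift_partial_rotation)
      (simp add: partial_rotation_def qc_def pc_def)
  then have "(\<Sum>i\<in>UNIV. pc i (legendre idx l z) * qc i ?D)
      = (\<Sum>i\<in>UNIV. pc i z * qc i v) - (\<Sum>i\<in>?I. pc i z * qc i v + pc i v * qc i z)"
    by (simp add: sum_subtractf flip: sum.inter_restrict)
  then show "pullback (legendre idx l) omega_cl z v = omega_cl z v"
    unfolding pullback_def D omega_cl_eq_sum q0 by simp
qed

section \<open>Consequences of \<alpha> being the gradient of S\<close>

text \<open>Each directional derivative of \<open>S\<close> is a fixed linear functional of
  \<alpha>, hence smooth.\<close>

lemma smooth_on_of_smooth_gradient: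
  fixes S :: "'a::euclidean_space \<Rightarrow> real"
  assumes "open U" "smooth_on U \<alpha>"
    and "\<And>A. A \<in> U \<Longrightarrow> (S has_derivative (\<lambda>v. \<alpha> A \<bullet> v)) (at A)"
  shows "smooth_on U S"
  using assms(1,3) smooth_on_compose_left[OF assms(1) bounded_linear_inner_left assms(2)]
  by (rule smooth_onI)

lemma differential_eq_gradient:
  fixes S :: "real^'m::finite \<Rightarrow> real"
  assumes "(S has_derivative (\<lambda>v. a \<bullet> v)) (at A)"
  shows "differential S A v = (\<Sum>i\<in>UNIV. a $ i * differential (\<lambda>B. B $ i) A v)"
  using frechet_derivative_at[OF assms, symmetric]
  by (simp add: differential_bounded_linear[OF bounded_linear_vec_nth])
    (simp add: differential_def inner_vec_def)

lemma partial_derivative_eq_gradient: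
  fixes S :: "real^'m::finite \<Rightarrow> real"
  assumes "(S has_derivative (\<lambda>v. a \<bullet> v)) (at A)"
  shows "((\<lambda>t. S (A + t *\<^sub>R axis i 1)) has_real_derivative a $ i) (at 0)"
proof -
  have "((\<lambda>t. A + t *\<^sub>R axis i 1) has_derivative (\<lambda>t. t *\<^sub>R axis i 1)) (at 0)"
    by (auto intro!: derivative_eq_intros)
  from has_derivative_compose[OF this, of S "\<lambda>v. a \<bullet> v"] assms show ?thesis
    by (simp add: has_field_derivative_def inner_axis mult.commute[of _ "a $ i"])
qed

subsection \<open>Entropy\<close>

lemma has_sum_pmf: "(pmf p has_sum 1) UNIV"
proof -
  have "pmf p summable_on UNIV"
    using abs_summable_equivalent[THEN iffD2, OF pmf_abs_summable] by (rule abs_summable_summable)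
  moreover have "infsum (pmf p) UNIV = 1"
    using infsetsum_infsum[OF pmf_abs_summable[of p UNIV]] infsetsum_pmf_eq_1[of p UNIV] by simp
  ultimately show ?thesis
    by (metis has_sum_infsum)
qed

text \<open>Isolates the term at \<open>x\<close>: when a single probability varies, the rest of
  each series in the Lagrangian is a constant.\<close>

lemma infsum_eq_off_point:
  fixes f g :: "'a \<Rightarrow> real"
  assumes "f summable_on UNIV" and "\<And>y. y \<noteq> x \<Longrightarrow> g y = f y"
  shows "infsum g UNIV = g x + infsum f (UNIV - {x})"
proof -
  have f: "f summable_on (UNIV - {x})"
    using assms(1) by (rule summable_on_subset_banach) simp
  have "g summable_on (UNIV - {x})"
    using f summable_on_cong[of "UNIV - {x}" g f] assms(2) by simp
  then have "infsum g (insert x (UNIV - {x})) = g x + infsum g (UNIV - {x})"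
    by (rule infsum_insert) simp
  also have "infsum g (UNIV - {x}) = infsum f (UNIV - {x})"
    using assms(2) by (intro infsum_cong) simp
  also have "insert x (UNIV - {x}) = UNIV"
    by blast
  finally show ?thesis .
qed

text \<open>The right-hand difference quotient is \<open>ln h\<close>, which tends to minus
  infinity. This excludes stationary points with a vanishing probability on the support of
  \<open>Q\<close>.\<close>

lemma x_ln_x_not_differentiable_at_0:
  "\<not> ((\<lambda>t::real. t * ln t) has_real_derivative D) (at 0)"
proof
  assume "((\<lambda>t::real. t * ln t) has_real_derivative D) (at 0)"
  then have "((\<lambda>h::real. h * ln h / h) \<longlongrightarrow> D) (at 0)"
    by (simp add: DERIV_def)
  then have "((\<lambda>h::real. h * ln h / h) \<longlongrightarrow> D) (at_right 0)"
    by (rule filterlim_mono) (auto intro: at_le)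
  moreover have "eventually (\<lambda>h::real. h * ln h / h = ln h) (at_right 0)"
    by (auto simp: eventually_at_filter)
  ultimately have "((\<lambda>h::real. ln h) \<longlongrightarrow> D) (at_right 0)"
    using Lim_transform_eventually by blast
  then show False
    using ln_at_0 not_tendsto_and_filterlim_at_infinity[of "at_right (0::real)" ln D]
    by (meson filterlim_at_bot_imp_at_infinity trivial_limit_at_right_real)
qed

text \<open>In one variable \<open>t = P x\<close> the Lagrangian is
  \<open>b * t - t * ln t + K\<close>, so stationarity yields \<open>ln t = b - 1\<close>. Since
  \<open>P\<close> has total mass 1, the constant \<open>c\<close> is minus the logarithm of the
  partition function.\<close>

lemma stationary_imp_gibbs_form:
  assumes P: "satisfies_constraints Ahat A P"
    and S: "relative_entropy P Q = ereal s"
    and mult: "lagrange_multipliers Q Ahat A P a"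
  obtains c where "\<And>x. pmf P x = exp c * gibbs_weight Q Ahat a x"
proof -
  \<comment> \<open>Finite entropy rules out the minus-infinity branch of the definition.\<close>
  have sub: "set_pmf P \<subseteq> set_pmf Q"
    and ent: "(\<lambda>x. pmf P x * ln (pmf P x) - pmf P x * ln (pmf Q x)) summable_on UNIV"
    using S by (auto simp: relative_entropy_def split: if_splits)
  obtain \<mu> where \<mu>: "\<And>x. x \<in> set_pmf Q \<Longrightarrow>
      ((\<lambda>t. lagrangian Q Ahat A \<mu> a ((pmf P)(x := t))) has_real_derivative 0) (at (pmf P x))"
    using mult by (auto simp: lagrange_multipliers_def)
  have "pmf P x = exp (- 1 - \<mu>) * gibbs_weight Q Ahat a x" for x
  proof (cases "x \<in> set_pmf Q")
    case False
    then have "pmf P x = 0" "pmf Q x = 0"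
      using sub by (auto simp: set_pmf_iff)
    then show ?thesis
      by (simp add: gibbs_weight_def)
  next
    case True
    let ?B = "\<Sum>i\<in>UNIV. a $ i * Ahat i x"
    \<comment> \<open>Collects the coefficients linear in \<open>t\<close> from the prior, the
      normalization and the expected values.\<close>
    define b where "b = ln (pmf Q x) - \<mu> - ?B"
    obtain K where K: "\<And>t. lagrangian Q Ahat A \<mu> a ((pmf P)(x := t)) = b * t - t * ln t + K"
    proof -
      let ?R = "UNIV - {x}"
      define K1 where "K1 = infsum (\<lambda>y. pmf P y * ln (pmf P y) - pmf P y * ln (pmf Q y)) ?R"
      define K2 where "K2 = infsum (pmf P) ?R"
      define K3 where "K3 i = infsum (\<lambda>y. pmf P y * Ahat i y) ?R" for i
      have "lagrangian Q Ahat A \<mu> a ((pmf P)(x := t))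
          = b * t - t * ln t + (- K1 - \<mu> * (K2 - 1) - (\<Sum>i\<in>UNIV. a $ i * (K3 i - A $ i)))" for t
      proof -
        let ?f = "(pmf P)(x := t)"
        have 1: "(\<Sum>\<^sub>\<infinity>y. ?f y * ln (?f y) - ?f y * ln (pmf Q y)) = t * ln t - t * ln (pmf Q x) + K1"
          using infsum_eq_off_point[OF ent, of x "\<lambda>y. ?f y * ln (?f y) - ?f y * ln (pmf Q y)"]
          by (simp add: K1_def)
        have 2: "(\<Sum>\<^sub>\<infinity>y. ?f y) = t + K2"
          using infsum_eq_off_point[OF has_sum_imp_summable[OF has_sum_pmf[of P]], of x ?f]
          by (simp add: K2_def fun_upd_def)
        have 3: "(\<Sum>\<^sub>\<infinity>y. ?f y * Ahat i y) = t * Ahat i x + K3 i" for i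
        proof -
          have "(\<lambda>y. pmf P y * Ahat i y) summable_on UNIV"
            using P by (auto simp: satisfies_constraints_def dest: has_sum_imp_summable)
          from infsum_eq_off_point[OF this, of x "\<lambda>y. ?f y * Ahat i y"] show ?thesis
            by (simp add: K3_def)
        qed
        have 4: "(\<Sum>i\<in>UNIV. a $ i * (t * Ahat i x + K3 i - A $ i))
            = t * ?B + (\<Sum>i\<in>UNIV. a $ i * (K3 i - A $ i))"
          by (simp add: sum_distrib_left sum.distrib[symmetric] algebra_simps)
        show ?thesis
          unfolding lagrangian_def 1 2 3 4 b_def by (simp add: algebra_simps)
      qed
      then show ?thesis
        by (rule that)
    qed
    have D: "((\<lambda>t. b * t - t * ln t + K) has_real_derivative 0) (at (pmf P x))"
      using \<mu>[OF True] by (simp add: K)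
    have "pmf P x \<noteq> 0"
    proof
      assume "pmf P x = 0"
      then have "((\<lambda>t. b * t - t * ln t + K) has_real_derivative 0) (at 0)"
        using D by simp
      \<comment> \<open>Subtracting from the affine part isolates \<open>t * ln t\<close>, which
        would become differentiable at 0.\<close>
      then have "((\<lambda>t. b * t + K - (b * t - t * ln t + K)) has_real_derivative b - 0) (at 0)"
        by (intro DERIV_diff) (auto intro!: derivative_eq_intros)
      then show False
        using x_ln_x_not_differentiable_at_0[of b] by simp
    qed
    then have pos: "pmf P x > 0"
      by (simp add: pmf_pos)
    have "((\<lambda>t. b * t - t * ln t + K) has_real_derivative b - (ln (pmf P x) + 1)) (at (pmf P x))"
      using pos by (auto intro!: derivative_eq_intros)
    with D have "b - (ln (pmf P x) + 1) = 0"
      using DERIV_unique by blast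
    then have "ln (pmf P x) = ln (pmf Q x) + ((- 1 - \<mu>) + - ?B)"
      by (simp add: b_def)
    then have "pmf P x = exp (ln (pmf Q x) + ((- 1 - \<mu>) + - ?B))"
      using pos by (metis exp_ln)
    also have "\<dots> = pmf Q x * (exp (- 1 - \<mu>) * exp (- ?B))"
      using True by (simp only: exp_add) (simp add: pmf_positive)
    finally show ?thesis
      by (simp add: gibbs_weight_def)
  qed
  then show ?thesis
    by (rule that)
qed

section \<open>Entropy of Gibbs distributions and Gibbs' inequality\<close>

lemma has_sum_finite_sum:
  fixes f :: "'i \<Rightarrow> 'a \<Rightarrow> 'b::topological_comm_monoid_add"
  assumes "\<And>i. i \<in> I \<Longrightarrow> (f i has_sum s i) A"
  shows "((\<lambda>x. \<Sum>i\<in>I. f i x) has_sum (\<Sum>i\<in>I. s i)) A"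
  using assms by (induction I rule: infinite_finite_induct) (auto intro: has_sum_add)

lemma has_sum_linear_constraint:
  assumes "satisfies_constraints Ahat A P"
  shows "((\<lambda>x. pmf P x * (\<Sum>i\<in>UNIV. a $ i * Ahat i x)) has_sum a \<bullet> A) UNIV"
proof -
  have "((\<lambda>x. \<Sum>i\<in>UNIV. a $ i * (pmf P x * Ahat i x)) has_sum (\<Sum>i\<in>UNIV. a $ i * A $ i)) UNIV"
    using assms by (intro has_sum_finite_sum has_sum_cmult_right) (auto simp: satisfies_constraints_def)
  then show ?thesis
    by (simp add: inner_vec_def sum_distrib_left algebra_simps)
qed

lemma has_sum_relative_entropy:
  assumes "relative_entropy P Q = ereal s"
  shows "((\<lambda>x. pmf P x * ln (pmf P x) - pmf P x * ln (pmf Q x)) has_sum - s) UNIV"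
  using assms by (auto simp: relative_entropy_def split: if_splits)

lemma ln_gibbs_form:
  assumes "pmf P x = exp c * gibbs_weight Q Ahat a x" and "x \<in> set_pmf Q"
  shows "pmf P x > 0"
    and "ln (pmf P x) = c + ln (pmf Q x) - (\<Sum>i\<in>UNIV. a $ i * Ahat i x)"
  using pmf_positive[OF assms(2)] assms(1) by (auto simp: gibbs_weight_def ln_mult)

text \<open>Inserting the logarithm of the Gibbs form and summing with normalization and constraints
  gives the entropy; as \<open>- c\<close> is \<open>log Z\<close>, this is the formula
  \<open>S = \<alpha> \<bullet> A + log Z\<close>.\<close>

lemma entropy_gibbs_form:
  assumes P: "\<And>x. pmf P x = exp c * gibbs_weight Q Ahat a x"
    and A: "satisfies_constraints Ahat A P"
    and S: "relative_entropy P Q = ereal s"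
  shows "s = a \<bullet> A - c"
proof -
  have eq: "pmf P x * ln (pmf P x) - pmf P x * ln (pmf Q x)
      = c * pmf P x + - (pmf P x * (\<Sum>i\<in>UNIV. a $ i * Ahat i x))" for x
  proof (cases "x \<in> set_pmf Q")
    case True
    show ?thesis
      by (simp add: ln_gibbs_form(2)[OF P True] algebra_simps)
  next
    case False
    then have "pmf P x = 0"
      by (simp add: P gibbs_weight_def set_pmf_iff)
    then show ?thesis by simp
  qed
  have "((\<lambda>x. pmf P x * ln (pmf P x) - pmf P x * ln (pmf Q x)) has_sum c * 1 + - (a \<bullet> A)) UNIV"
    unfolding eq
    by (intro has_sum_add has_sum_cmult_right has_sum_uminusI has_sum_pmf has_sum_linear_constraint A)
  from has_sum_unique[OF this has_sum_relative_entropy[OF S]] show ?thesis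
    by simp
qed

text \<open>Gibbs' inequality, summed from \<open>r * ln (p / r) \<le> p - r\<close>. The multiplier
  \<open>a\<close> belongs to \<open>P\<close>, the expected values \<open>B\<close> to the
  competitor \<open>R\<close>; this mixture yields the supergradient bound for
  \<open>S\<close>.\<close>

lemma entropy_le_gibbs:
  assumes P: "\<And>x. pmf P x = exp c * gibbs_weight Q Ahat a x"
    and B: "satisfies_constraints Ahat B R"
    and S: "relative_entropy R Q = ereal s"
  shows "s \<le> a \<bullet> B - c"
proof -
  have sub: "set_pmf R \<subseteq> set_pmf Q"
    using S by (auto simp: relative_entropy_def split: if_splits)
  have le: "pmf R x + - pmf P x \<le> (pmf R x * ln (pmf R x) - pmf R x * ln (pmf Q x))
      + (pmf R x * (\<Sum>i\<in>UNIV. a $ i * Ahat i x) + - c * pmf R x)" for x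
  proof (cases "x \<in> set_pmf R")
    case True
    then have r: "pmf R x > 0" and x: "x \<in> set_pmf Q"
      using sub by (auto simp: pmf_positive)
    have p: "pmf P x > 0"
      by (rule ln_gibbs_form[OF P x])
    have "pmf R x * ln (pmf P x / pmf R x) \<le> pmf R x * (pmf P x / pmf R x - 1)"
      using r p by (intro mult_left_mono ln_le_minus_one) auto
    then have "pmf R x - pmf P x \<le> pmf R x * ln (pmf R x) - pmf R x * ln (pmf P x)"
      using r p by (simp add: ln_div algebra_simps)
    then show ?thesis
      by (simp add: ln_gibbs_form(2)[OF P x] algebra_simps)
  next
    \<comment> \<open>Where \<open>R\<close> vanishes the right-hand side is 0 and the left-hand
      side is \<open>- pmf P x\<close>.\<close>
    case False
    then show ?thesis by (simp add: set_pmf_iff)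
  qed
  have "((\<lambda>x. pmf R x + - pmf P x) has_sum 1 + - 1) UNIV"
    by (intro has_sum_add has_sum_uminusI has_sum_pmf)
  moreover have "((\<lambda>x. (pmf R x * ln (pmf R x) - pmf R x * ln (pmf Q x))
      + (pmf R x * (\<Sum>i\<in>UNIV. a $ i * Ahat i x) + - c * pmf R x)) has_sum - s + (a \<bullet> B + - c * 1)) UNIV"
    by (intro has_sum_add has_sum_cmult_right has_sum_pmf
        has_sum_relative_entropy[OF S] has_sum_linear_constraint[OF B])
  ultimately have "1 + - 1 \<le> - s + (a \<bullet> B + - c * 1)"
    by (rule has_sum_mono) (rule le)
  then show ?thesis by simp
qed

section \<open>Differentiability of the entropy and the theorem\<close>

text \<open>The supergradient inequality at \<open>A\<close> and at \<open>B\<close> places the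
  first-order error between \<open>(\<alpha> B - \<alpha> A) \<bullet> (B - A)\<close> and 0.
  Cauchy-Schwarz and continuity of \<alpha> make this \<open>o(norm (B - A))\<close>.\<close>

lemma has_derivative_of_supergradient:
  fixes S :: "'a::euclidean_space \<Rightarrow> real" and \<alpha> :: "'a \<Rightarrow> 'a"
  assumes "open U" "continuous_on U \<alpha>" "A \<in> U"
    and super: "\<And>A B. A \<in> U \<Longrightarrow> B \<in> U \<Longrightarrow> S B \<le> S A + \<alpha> A \<bullet> (B - A)"
  shows "(S has_derivative (\<lambda>v. \<alpha> A \<bullet> v)) (at A)"
  unfolding has_derivative_at_alt
proof (intro conjI allI impI)
  show "bounded_linear (\<lambda>v. \<alpha> A \<bullet> v)"
    by (rule bounded_linear_inner_right)
  fix e :: real assume "e > 0"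
  obtain d1 where d1: "d1 > 0" "ball A d1 \<subseteq> U"
    using assms(1,3) openE by blast
  obtain d2 where d2: "d2 > 0" "\<And>B. B \<in> U \<Longrightarrow> dist B A < d2 \<Longrightarrow> dist (\<alpha> B) (\<alpha> A) < e"
    using assms(2,3) \<open>e > 0\<close> unfolding continuous_on_iff by blast
  have "norm (S B - S A - \<alpha> A \<bullet> (B - A)) \<le> e * norm (B - A)" if "norm (B - A) < min d1 d2" for B
  proof -
    have B: "B \<in> U"
      using that d1 by (auto simp: dist_norm norm_minus_commute)
    have "\<bar>(\<alpha> B - \<alpha> A) \<bullet> (B - A)\<bar> \<le> norm (\<alpha> B - \<alpha> A) * norm (B - A)"
      by (rule Cauchy_Schwarz_ineq2)
    also have "\<dots> \<le> e * norm (B - A)"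
      using d2(2)[OF B] that by (intro mult_right_mono) (auto simp: dist_norm)
    finally have "\<bar>\<alpha> B \<bullet> (B - A) - \<alpha> A \<bullet> (B - A)\<bar> \<le> e * norm (B - A)"
      by (simp add: inner_diff_left)
    moreover have "S B - S A \<le> \<alpha> A \<bullet> (B - A)" "\<alpha> B \<bullet> (B - A) \<le> S B - S A"
      using super[OF assms(3) B] super[OF B assms(3)] by (auto simp: inner_diff_right)
    ultimately show ?thesis by (simp only: real_norm_def)
  qed
  then show "\<exists>d>0. \<forall>B. norm (B - A) < d \<longrightarrow> norm (S B - S A - \<alpha> A \<bullet> (B - A)) \<le> e * norm (B - A)"
    using d1 d2 by (intro exI[of _ "min d1 d2"]) auto
qed

theorem mainTheorem5:
  fixes Q :: "'x pmf"
    and Ahat :: "'m::finite \<Rightarrow> 'x \<Rightarrow> real"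
    and U V :: "(real^'m) set"
    and S :: "real^'m \<Rightarrow> real"
    and \<alpha> :: "real^'m \<Rightarrow> real^'m"
    and idx :: "nat \<Rightarrow> 'm"
  assumes "open U" and "smooth_on U \<alpha>"
    and "\<And>A. A \<in> U \<Longrightarrow>
           \<exists>P. entropy_maximizer Q Ahat A P \<and> relative_entropy P Q = ereal (S A) \<and>
               lagrange_multipliers Q Ahat A P (\<alpha> A)"
    and "open V" and "\<alpha> ` U \<subseteq> V"
    and "\<And>a. a \<in> V \<Longrightarrow> gibbs_weight Q Ahat a summable_on UNIV"
    and "\<And>a. a \<in> V \<Longrightarrow> partition_function Q Ahat differentiable (at a)"
    and "bij_betw idx {1..CARD('m)} UNIV"
  shows "smooth_on U S \<and>
    (\<forall>A\<in>U. \<forall>v. differential S A v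
        - (\<Sum>i\<in>UNIV. \<alpha> A $ i * differential (\<lambda>B. B $ i) A v) = 0) \<and>
    (\<forall>A\<in>U. \<forall>i. ((\<lambda>t. S (A + t *\<^sub>R axis i 1)) has_real_derivative \<alpha> A $ i) (at 0)) \<and>
    contact_form (omega_cl :: 'm phase_space one_form) \<and>
    submanifold CARD('m) (state_manifold U S \<alpha>) \<and>
    vanishes_on omega_cl (state_manifold U S \<alpha>) \<and>
    (\<forall>l\<in>{1..CARD('m)}.
        diffeomorphism UNIV UNIV (legendre idx l) \<and>
        pullback (legendre idx l) omega_cl = omega_cl)"
proof -
  have "\<exists>c P. (\<forall>x. pmf P x = exp c * gibbs_weight Q Ahat (\<alpha> A) x) \<and>
      satisfies_constraints Ahat A P \<and> relative_entropy P Q = ereal (S A)" if "A \<in> U" for A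
  proof -
    obtain P where P: "entropy_maximizer Q Ahat A P" "relative_entropy P Q = ereal (S A)"
      "lagrange_multipliers Q Ahat A P (\<alpha> A)"
      using assms(3)[OF \<open>A \<in> U\<close>] by blast
    have A: "satisfies_constraints Ahat A P"
      using P(1) by (simp add: entropy_maximizer_def)
    obtain c where "\<And>x. pmf P x = exp c * gibbs_weight Q Ahat (\<alpha> A) x"
      using stationary_imp_gibbs_form[OF A P(2,3)] by blast
    with A P(2) show ?thesis by blast
  qed
  then obtain c P where form: "\<And>A x. A \<in> U \<Longrightarrow> pmf (P A) x = exp (c A) * gibbs_weight Q Ahat (\<alpha> A) x"
    and con: "\<And>A. A \<in> U \<Longrightarrow> satisfies_constraints Ahat A (P A)"
    and ent: "\<And>A. A \<in> U \<Longrightarrow> relative_entropy (P A) Q = ereal (S A)"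
    by metis
  \<comment> \<open>The equality \<open>S A = \<alpha> A \<bullet> A - c A\<close> and the bound
    \<open>S B \<le> \<alpha> A \<bullet> B - c A\<close> share the constant \<open>c A\<close>,
    which cancels.\<close>
  have super: "S B \<le> S A + \<alpha> A \<bullet> (B - A)" if "A \<in> U" "B \<in> U" for A B
    using entropy_gibbs_form[OF form con ent, OF that(1) that(1) that(1)]
      entropy_le_gibbs[OF form con ent, OF that(1) that(2) that(2)]
    by (simp add: inner_diff_right)
  have "Ck_on 0 U \<alpha>"
    using assms(2) unfolding smooth_on_def by blast
  then have "continuous_on U \<alpha>"
    by simp
  then have gradient: "(S has_derivative (\<lambda>v. \<alpha> A \<bullet> v)) (at A)" if "A \<in> U" for A
    using assms(1) that super by (intro has_derivative_of_supergradient)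
  have smooth: "smooth_on U S"
    by (rule smooth_on_of_smooth_gradient[OF assms(1,2) gradient])
  have inj: "inj_on idx {1..l}" if "l \<in> {1..CARD('m)}" for l
    using bij_betw_imp_inj_on[OF assms(8)] by (rule inj_on_subset) (use that in auto)
  show ?thesis
    using smooth contact_form_omega_cl submanifold_state_manifold[OF assms(1) smooth assms(2)]
      vanishes_on_state_manifold[OF gradient] partial_derivative_eq_gradient[OF gradient]
      differential_eq_gradient[OF gradient] diffeomorphism_legendre[OF inj]
      pullback_legendre_omega_cl[OF inj]
    by simp
qed

end
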